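(* For all real $s \ge 7$, $$1-\varepsilon(s)<\frac{1}{P(s)} - \frac{1}{\zeta(s)-1} < 1+\delta(s).$$
   Context: $\zeta(s)=\sum_{m=1}^{\infty} m^{-s}$ is the Riemann zeta function and $P(s)=\sum_{m=1}^{\infty} p_m^{-s}$ is the prime zeta function, $p_m$ being the $m$-th prime. For real $s$, $\varepsilon(s)=2^s \left( \left( \frac{2}{3} \right)^s + \left( \frac{1}{2} \right)^s \right)^2$ and $\delta(s)=2^s \left( \left( \frac{2}{3} \right)^s+\left( \frac{2}{5} \right)^s \right)^2 -\left( \frac{4}{5} \right)^s$. *)

theory Defs
  imports "HOL-Analysis.Analysis" "HOL-Computational_Algebra.Primes"
begin

text \<open>
  The zeta functions are defined by their Dirichlet series on the real line; the series converge
  for \<open>s > 1\<close>, and the values for \<open>s \<le> 1\<close> are meaningless. Sequences are indexed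
  from 0, so \<open>nth_prime 0 = 2\<close>.
\<close>

definition riemann_zeta :: "real \<Rightarrow> real" where
  "riemann_zeta s = (\<Sum>m. real (Suc m) powr (- s))"

definition nth_prime :: "nat \<Rightarrow> nat" where
  "nth_prime m = enumerate {p. prime p} m"

definition prime_zeta :: "real \<Rightarrow> real" where
  "prime_zeta s = (\<Sum>m. real (nth_prime m) powr (- s))"

definition eps :: "real \<Rightarrow> real" where
  "eps s = 2 powr s * ((2 / 3) powr s + (1 / 2) powr s)\<^sup>2"

definition delta :: "real \<Rightarrow> real" where
  "delta s = 2 powr s * ((2 / 3) powr s + (2 / 5) powr s)\<^sup>2 - (4 / 5) powr s"

end

theory Submission
  imports Defs "HOL-Real_Asymp.Real_Asymp"
begin

text \<open>
  Write \<open>Z = \<zeta>(s) - 1\<close>, let \<open>P\<close> be the prime zeta function and \<open>C = Z - P\<close> the sum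
  over composite numbers, so that \<open>1 / P - 1 / Z = C / (P Z)\<close>. With \<open>a = 2\<^sup>-\<^sup>s\<close> and
  \<open>x = (2/3)\<^sup>s\<close>, both \<open>C / a\<^sup>2\<close> and \<open>Z / a\<close> are \<open>1 + x + a\<close> and \<open>P / a\<close> is
  \<open>1 + x\<close>, up to tails that are negligible for \<open>s \<ge> 7\<close>. Hence the quotient is about
  \<open>1 / (1 + x)\<close>; it is below \<open>1 < 1 + \<delta>(s)\<close>, and exceeds
  \<open>1 - 2 x > 1 - \<epsilon>(s)\<close>.
\<close>

lemma summable_powr_minus_nat:
  fixes s :: real
  assumes "s > 1"
  shows "summable (\<lambda>n. real n powr (- s))"
  using assms by (simp add: summable_real_powr_iff)

text \<open>Comparison with \<open>k\<^sup>2\<^sup>-\<^sup>s n\<^sup>-\<^sup>2\<close>, which in turn is dominated by a telescoping series.\<close>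

lemma powr_minus_tail_le:
  fixes s :: real and k :: nat
  assumes "s \<ge> 2" "k \<ge> 2"
  shows "(\<Sum>n. real (n + k) powr (- s)) \<le> real k ^ 2 / (real k - 1) * real k powr (- s)"
proof -
  define c where "c = real k ^ 2 * real k powr (- s)"
  have "(\<lambda>n. 1 / (real n + real k - 1)) \<longlonglongrightarrow> 0"
    by real_asymp
  from telescope_sums'[OF this]
  have tele: "(\<lambda>n. 1 / (real n + real k - 1) - 1 / (real (Suc n) + real k - 1)) sums
      (1 / (real k - 1))"
    by simp
  have le: "real (n + k) powr (- s) \<le>
      c * (1 / (real n + real k - 1) - 1 / (real (Suc n) + real k - 1))" for n
  proof -
    have k: "real k \<ge> 2" using assms by simp
    have "real (n + k) powr (- s) = real (n + k) powr (2 - s) * real (n + k) powr (- 2)"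
      by (simp flip: powr_add)
    also have "\<dots> \<le> real k powr (2 - s) * real (n + k) powr (- 2)"
      using assms by (intro mult_right_mono powr_mono2') auto
    also have "real k powr (2 - s) = c"
      using k by (simp add: c_def powr_diff powr_minus field_simps)
    also have "real (n + k) powr (- 2) = 1 / (real n + real k) ^ 2"
      using k by (simp add: powr_minus field_simps)
    also have "c * (1 / (real n + real k) ^ 2) \<le>
        c * (1 / (real n + real k - 1) - 1 / (real (Suc n) + real k - 1))"
    proof (rule mult_left_mono)
      define m where "m = real n + real k"
      have "m \<ge> 2" using k by (simp add: m_def)
      then have "1 / m ^ 2 \<le> 1 / (m - 1) - 1 / m"
        by (simp add: field_simps power2_eq_square)
      then show "1 / (real n + real k) ^ 2 \<le>
          1 / (real n + real k - 1) - 1 / (real (Suc n) + real k - 1)"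
        by (simp add: m_def)
    qed (simp add: c_def)
    finally show ?thesis .
  qed
  have "summable (\<lambda>n. real (n + k) powr (- s))"
    using summable_ignore_initial_segment[OF summable_powr_minus_nat, of s k] assms by simp
  moreover have "(\<lambda>n. c * (1 / (real n + real k - 1) - 1 / (real (Suc n) + real k - 1))) sums
      (c * (1 / (real k - 1)))"
    by (intro sums_mult tele)
  ultimately have "(\<Sum>n. real (n + k) powr (- s)) \<le> c * (1 / (real k - 1))"
    using le by (intro sums_le[OF _ summable_sums]) auto
  then show ?thesis by (simp add: c_def)
qed

text \<open>Indexing by the integers themselves, with zeros off \<open>A\<close>, lets the series
  over all, prime and composite numbers be split termwise and truncated at a common point.\<close>

definition powr_on :: "nat set \<Rightarrow> real \<Rightarrow> nat \<Rightarrow> real" where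
  "powr_on A s n = (if n \<in> A then real n powr (- s) else 0)"

lemma summable_powr_on:
  assumes "s > 1"
  shows "summable (powr_on A s)"
  by (rule summable_comparison_test'[OF summable_powr_minus_nat[OF assms], of 0])
     (auto simp: powr_on_def)

lemma suminf_powr_on_ge:
  assumes "s > 1"
  shows "(\<Sum>n<k. powr_on A s n) \<le> suminf (powr_on A s)"
  by (intro sum_le_suminf summable_powr_on[OF assms]) (auto simp: powr_on_def)

text \<open>The terms from \<open>k\<close> on are at most those of the full series, so one error
  term serves every \<open>A\<close>.\<close>

lemma suminf_powr_on_le:
  assumes "s \<ge> 2" "k \<ge> 2"
  shows "suminf (powr_on A s) \<le>
    (\<Sum>n<k. powr_on A s n) + real k ^ 2 / (real k - 1) * real k powr (- s)"
proof -
  have s: "s > 1" using assms by simp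
  have "(\<Sum>n. powr_on A s (n + k)) \<le> (\<Sum>n. real (n + k) powr (- s))"
    by (intro suminf_le summable_ignore_initial_segment[OF summable_powr_on[OF s]]
          summable_ignore_initial_segment[OF summable_powr_minus_nat[OF s]])
       (auto simp: powr_on_def)
  also note powr_minus_tail_le[OF assms]
  finally show ?thesis
    using suminf_split_initial_segment[OF summable_powr_on[OF s], of A k] by simp
qed

lemma riemann_zeta_minus_1_eq:
  assumes "s > 1"
  shows "riemann_zeta s - 1 = suminf (powr_on {2..} s)"
proof -
  have sm: "summable (\<lambda>n. real (Suc n) powr (- s))"
    using summable_ignore_initial_segment[OF summable_powr_minus_nat[OF assms], of 1] by simp
  have "riemann_zeta s = (\<Sum>n. real (Suc (Suc n)) powr (- s)) + 1"
    unfolding riemann_zeta_def using suminf_split_head[OF sm] by simp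
  moreover have "suminf (powr_on {2..} s) = (\<Sum>n. real (Suc (Suc n)) powr (- s))"
    using suminf_split_initial_segment[OF summable_powr_on[OF assms], of "{2..}" 2]
    by (simp add: powr_on_def numeral_2_eq_2)
  ultimately show ?thesis by simp
qed

text \<open>Reindexing along the strictly increasing \<open>nth_prime\<close> skips only zero terms,
  which requires no convergence and hence no condition on \<open>s\<close>.\<close>

lemma prime_zeta_eq: "prime_zeta s = suminf (powr_on {p. prime p} s)"
proof -
  have inf: "infinite {p::nat. prime p}" by (rule primes_infinite)
  have "range nth_prime = {p. prime p}"
    using range_enumerate[OF inf] by (auto simp: nth_prime_def[abs_def])
  moreover have "strict_mono nth_prime"
    using strict_mono_enumerate[OF inf] by (simp add: nth_prime_def[abs_def])
  ultimately have "(\<Sum>m. powr_on {p. prime p} s (nth_prime m)) = suminf (powr_on {p. prime p} s)"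
    by (intro suminf_mono_reindex) (auto simp: powr_on_def)
  moreover have "powr_on {p. prime p} s (nth_prime m) = real (nth_prime m) powr (- s)" for m
    using \<open>range nth_prime = _\<close> by (auto simp: powr_on_def)
  ultimately show ?thesis by (simp add: prime_zeta_def)
qed

theorem theorem1p6:
  fixes s :: real
  assumes "s \<ge> 7"
  shows "1 - eps s < 1 / prime_zeta s - 1 / (riemann_zeta s - 1) \<and>
         1 / prime_zeta s - 1 / (riemann_zeta s - 1) < 1 + delta s"
proof -
  define a x w where "a = 2 powr (- s)" and "x = (2 / 3) powr s" and "w = (2 / 5) powr s"
  define P Z C where "P = prime_zeta s" and "Z = riemann_zeta s - 1"
    and "C = suminf (powr_on {n. n \<ge> 2 \<and> \<not> prime n} s)"
  have s: "s > 1" "s \<ge> 2" using assms by auto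
  have pos: "a > 0" "x > 0" "w > 0" by (simp_all add: a_def x_def w_def)

  have powers: "3 powr (- s) = a * x" "4 powr (- s) = a\<^sup>2" "5 powr (- s) = a * w"
    "6 powr (- s) = a\<^sup>2 * x" "8 powr (- s) = a ^ 3" "9 powr (- s) = a\<^sup>2 * x\<^sup>2"
  proof -
    have p: "4 = 2 * (2::real)" "6 = 2 * (3::real)" "8 = 2 * (2 * (2::real))" "9 = 3 * (3::real)"
      by simp_all
    show 3: "3 powr (- s) = a * x" and "5 powr (- s) = a * w"
      by (simp_all add: a_def x_def w_def powr_divide powr_minus inverse_eq_divide)
    show "4 powr (- s) = a\<^sup>2" unfolding p(1) powr_mult by (simp add: a_def power2_eq_square)
    show "8 powr (- s) = a ^ 3" unfolding p(3) powr_mult by (simp add: a_def power3_eq_cube)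
    show "6 powr (- s) = a\<^sup>2 * x" unfolding p(2) powr_mult 3 by (simp add: a_def power2_eq_square)
    show "9 powr (- s) = a\<^sup>2 * x\<^sup>2" unfolding p(4) powr_mult 3 by (simp add: power2_eq_square)
  qed

  \<comment> \<open>Here s \<ge> 7 enters numerically: (2/3)^7 = 128/2187 < 0.06. Likewise (3/5)^7 <
    0.03 in the next estimate.\<close>
  have x_small: "x \<le> 3 / 50"
  proof -
    have "x \<le> (2 / 3) powr 7" unfolding x_def using assms by (intro powr_mono') auto
    then show ?thesis by (simp add: field_simps)
  qed
  have w_le_x: "w \<le> 3 / 100 * x"
  proof -
    have "w = x * (3 / 5) powr s" by (simp add: w_def x_def flip: powr_mult)
    also have "(3 / 5) powr s \<le> (3 / 5) powr 7" using assms by (intro powr_mono') auto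
    also have "\<dots> \<le> (3 / 100 :: real)" by (simp add: field_simps)
    finally show ?thesis using pos by (simp add: mult_left_mono mult.commute)
  qed
  \<comment> \<open>This holds because 2/5 < 4/9 = (2/3)^2; it serves only to make
    \<open>delta s\<close> nonnegative.\<close>
  have w_le_sq: "w \<le> x\<^sup>2"
  proof -
    have "x\<^sup>2 = (4 / 9) powr s" by (simp add: x_def power2_eq_square flip: powr_mult)
    then show ?thesis unfolding w_def using assms by (simp add: powr_mono2)
  qed

  have split: "Z = P + C"
  proof -
    have "powr_on {2..} s n =
        powr_on {p. prime p} s n + powr_on {n. n \<ge> 2 \<and> \<not> prime n} s n" for n
      using prime_ge_2_nat[of n] by (auto simp: powr_on_def)
    then have "powr_on {2..} s =
        (\<lambda>n. powr_on {p. prime p} s n + powr_on {n. n \<ge> 2 \<and> \<not> prime n} s n)"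
      by blast
    then show ?thesis
      unfolding Z_def P_def C_def riemann_zeta_minus_1_eq[OF s(1)] prime_zeta_eq
      by (simp add: suminf_add[OF summable_powr_on[OF s(1)] summable_powr_on[OF s(1)]])
  qed

  have not_prime: "\<not> prime (4::nat)" "\<not> prime (6::nat)" "\<not> prime (8::nat)"
    using prime_odd_nat[of 4] prime_odd_nat[of 6] prime_odd_nat[of 8] by auto
  have upt: "{..<4::nat} = {0, 1, 2, 3}" "{..<5::nat} = {0, 1, 2, 3, 4}"
    "{..<9::nat} = {0, 1, 2, 3, 4, 5, 6, 7, 8}"
    by auto
  have prime: "prime (2::nat)" "prime (3::nat)" "prime (5::nat)" "prime (7::nat)"
    by simp_all
  \<comment> \<open>\<open>a * t\<close> is the tail bound from 5 on: 25/4 is k^2/(k - 1) at k = 5,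
    and 5^(-s) = \<open>a * w\<close>.\<close>
  define t where "t = 25 / 4 * w"
  have P_ge: "P \<ge> a * (1 + x)"
    using suminf_powr_on_ge[OF s(1), of "{p. prime p}" 4]
    by (simp add: P_def prime_zeta_eq upt powr_on_def prime not_prime powers a_def[symmetric]
        algebra_simps)
  have P_le: "P \<le> a * (1 + x + t)"
    using suminf_powr_on_le[OF s(2), of 5 "{p. prime p}"]
    by (simp add: P_def prime_zeta_eq upt powr_on_def prime not_prime powers a_def[symmetric]
        t_def algebra_simps)
  have Z_ge: "Z \<ge> a * (1 + x + a)"
    using suminf_powr_on_ge[OF s(1), of "{2..}" 5]
    by (simp add: Z_def riemann_zeta_minus_1_eq[OF s(1)] upt powr_on_def powers a_def[symmetric]
        power2_eq_square algebra_simps)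
  have Z_le: "Z \<le> a * (1 + x + a + t)"
    using suminf_powr_on_le[OF s(2), of 5 "{2..}"]
    by (simp add: Z_def riemann_zeta_minus_1_eq[OF s(1)] upt powr_on_def powers a_def[symmetric]
        t_def power2_eq_square algebra_simps)
  \<comment> \<open>Cutting at 9 retains exactly the composites 4, 6 and 8. In the upper bound, 81/8
    is k^2/(k - 1) at k = 9, and 9^(-s) is the square of \<open>a * x\<close>.\<close>
  have C_ge: "C \<ge> a\<^sup>2 * (1 + x + a)"
    using suminf_powr_on_ge[OF s(1), of "{n. n \<ge> 2 \<and> \<not> prime n}" 9]
    by (simp add: C_def upt powr_on_def prime not_prime powers power2_eq_square power3_eq_cube
        algebra_simps)
  have C_le: "C \<le> a\<^sup>2 * (1 + x + a + 81 / 8 * x\<^sup>2)"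
    using suminf_powr_on_le[OF s(2), of 9 "{n. n \<ge> 2 \<and> \<not> prime n}"]
    by (simp add: C_def upt powr_on_def prime not_prime powers power2_eq_square power3_eq_cube
        algebra_simps)

  have PZ_pos: "P > 0" "Z > 0"
    using P_ge Z_ge pos by (auto intro: less_le_trans[rotated])
  have quot: "1 / P - 1 / Z = C / (P * Z)"
    using PZ_pos by (simp add: split field_simps)
  have t: "0 < t" "2 * t < x" using w_le_x pos by (auto simp: t_def)

  have two_s: "2 powr s = 1 / a" by (simp add: a_def powr_minus inverse_eq_divide)
  have eps: "eps s > x + 2 * t"
  proof -
    have "(1 / 2) powr s = a" by (simp add: a_def powr_minus powr_divide inverse_eq_divide)
    then have "eps s = (x + a)\<^sup>2 / a" by (simp add: eps_def two_s x_def)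
    also have "\<dots> = x\<^sup>2 / a + 2 * x + a" using pos by (simp add: field_simps power2_eq_square)
    also have "\<dots> > x + 2 * t" using pos t by (smt (verit) divide_nonneg_pos zero_le_power2)
    finally show ?thesis .
  qed
  \<comment> \<open>The subtracted term (4/5)^s equals \<open>w / a\<close>, so the sign is that of
    (x + w)^2 - w, where w \<le> x^2.\<close>
  have delta: "delta s \<ge> 0"
  proof -
    have "(4 / 5) powr s = 2 powr s * w" by (simp add: w_def flip: powr_mult)
    then have "delta s = ((x + w)\<^sup>2 - w) / a"
      by (simp add: delta_def two_s x_def w_def diff_divide_distrib)
    moreover have "w \<le> (x + w)\<^sup>2"
      using pos by (intro order.trans[OF w_le_sq] power_mono) auto
    ultimately show ?thesis using pos by simp
  qed

  \<comment> \<open>The product (1 + x)(1 + x + a) exceeds 1 + x + a by x + x(x + a), which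
    outweighs the tail of \<open>C\<close> because 81/8 * x < 1.\<close>
  have upper: "C < P * Z"
  proof -
    have "81 / 8 * x\<^sup>2 < x" using x_small pos by (simp add: power2_eq_square)
    moreover have "0 < x * (x + a)" using pos by simp
    ultimately have "1 + x + a + 81 / 8 * x\<^sup>2 < (1 + x) * (1 + x + a)"
      by (simp add: algebra_simps)
    then have "C < a\<^sup>2 * ((1 + x) * (1 + x + a))"
      using C_le pos by (smt (verit) mult_strict_left_mono zero_less_power)
    also have "\<dots> = (a * (1 + x)) * (a * (1 + x + a))" by (simp add: power2_eq_square)
    also have "\<dots> \<le> P * Z" using P_ge Z_ge pos PZ_pos by (intro mult_mono) auto
    finally show ?thesis .
  qed
  \<comment> \<open>Since \<open>eps s\<close> exceeds x + 2t, the factor 1 - \<open>eps s\<close>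
    is below (1 - (x + t))(1 - t). The first factor offsets 1 + x + t in the bound for
    \<open>P\<close>, leaving at most \<open>a\<close>; the second absorbs the tail of
    \<open>Z\<close>. What remains is the lower bound for \<open>C\<close>.\<close>
  have lower: "(1 - eps s) * (P * Z) < C"
  proof -
    have "(1 - (x + t)) * P \<le> (1 - (x + t)) * (a * (1 + x + t))"
      using P_le t x_small by (intro mult_left_mono) auto
    also have "\<dots> = a * (1 - (x + t)\<^sup>2)" by (simp add: algebra_simps power2_eq_square)
    also have "\<dots> \<le> a" using pos by simp
    finally have P': "(1 - (x + t)) * P \<le> a" .
    have "(1 - t) * Z \<le> (1 - t) * (a * (1 + x + a + t))"
      using Z_le t x_small by (intro mult_left_mono) auto
    also have "\<dots> = a * (1 + x + a) - a * t * (x + a + t)" by (simp add: algebra_simps)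
    also have "\<dots> \<le> a * (1 + x + a)" using pos t by simp
    finally have Z': "(1 - t) * Z \<le> a * (1 + x + a)" .
    have "0 < (x + t) * t" using pos t by simp
    then have "1 - eps s < (1 - (x + t)) * (1 - t)"
      using eps by (simp add: algebra_simps)
    then have "(1 - eps s) * (P * Z) < (1 - (x + t)) * (1 - t) * (P * Z)"
      using PZ_pos by (intro mult_strict_right_mono) auto
    also have "\<dots> = ((1 - (x + t)) * P) * ((1 - t) * Z)" by simp
    also have "\<dots> \<le> a * (a * (1 + x + a))"
      using PZ_pos pos t x_small by (intro mult_mono[OF P' Z']) auto
    also have "\<dots> \<le> C" using C_ge by (simp add: power2_eq_square)
    finally show ?thesis .
  qed
  have "1 - eps s < C / (P * Z)" "C / (P * Z) < 1"
    using lower upper PZ_pos by (simp_all add: pos_less_divide_eq)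
  then show ?thesis using delta quot unfolding P_def Z_def by simp
qed

end
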